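(* Let $(X,\le,c)$ be a finite strongly involution poset. (i) If $A\in\mathcal{W}_+(X,\mathbf{2})$ and $W$ is a $\mathcal{W}_+(X,\mathbf{2})$-core for $A$, then $X$ is the disjoint union $$X=\big[\uparrow W_P^A\cup\uparrow (W_N^A)^c\big]\ \sqcup\ \downarrow W_N^A.$$ (ii) If $A\in\mathcal{W}_-(X,\mathbf{2})$ and $W$ is a $\mathcal{W}_-(X,\mathbf{2})$-core for $A$, then $$X=\big[\downarrow W_N^A\cup\downarrow (W_P^A)^c\big]\ \sqcup\ \uparrow W_P^A.$$
   Context: A strongly involution poset is a poset $(X,\le)$ with $c:X\to X$, $x\mapsto x^c$, such that $(x^c)^c=x$, $x\le y\Rightarrow y^c\le x^c$, and $x^c\ne x$ for all $x$ (when $|X|\ge2$). For $Z\subseteq X$: $Z^c=\{z^c:z\in Z\}$, $\uparrow Z=\{x:\exists z\in Z,\ z\le x\}$, $\downarrow Z=\{x:\exists z\in Z,\ x\le z\}$. $\mathbf{2}$ is the chain $N<P$. For a map $A$ into $\mathbf{2}$ and $Z\subseteq X$, $Z_P^A=A^{-1}(P)\cap Z$ and $Z_N^A=A^{-1}(N)\cap Z$. $\mathcal{W}_+(X,\mathbf{2})$ (resp. $\mathcal{W}_-(X,\mathbf{2})$) is the set of maps $A:X\to\mathbf{2}$ such that $A^{-1}(P)$ is an up-set, $A^{-1}(N)$ is a down-set, and $A^{-1}(N)^c\subseteq A^{-1}(P)$ (resp. $A^{-1}(P)^c\subseteq A^{-1}(N)$). For a family $\mathcal{H}$ of total maps $X\to\mathbf{2}$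 and $A\in\mathcal{H}$, $W\subseteq X$ is an $\mathcal{H}$-core for $A$ if every $A'\in\mathcal{H}$ with $A'|_W=A|_W$ satisfies $A'=A$.
   Formalization: The formal theorem assumes |X| ≥ 2: for a one-point X with x^c = x, the set W_+ contains only the constant map P, so W = ∅ is a core while the right-hand side of (i) is empty (dually for (ii)). *)

theory Defs imports Main begin

datatype two = two_N | two_P

instantiation two :: linorder
begin

definition less_eq_two :: "two \<Rightarrow> two \<Rightarrow> bool"
  where "a \<le> b \<longleftrightarrow> a = two_N \<or> b = two_P"

definition less_two :: "two \<Rightarrow> two \<Rightarrow> bool"
  where "a < b \<longleftrightarrow> a = two_N \<and> b = two_P"

instance
proof
  fix x y z :: two
  show "x < y \<longleftrightarrow> x \<le> y \<and> \<not> y \<le> x"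
    by (cases x; cases y) (simp_all add: less_two_def less_eq_two_def)
  show "x \<le> x"
    by (cases x) (simp_all add: less_eq_two_def)
  show "x \<le> z" if "x \<le> y" "y \<le> z"
    using that by (auto simp: less_eq_two_def)
  show "x = y" if "x \<le> y" "y \<le> x"
    using that by (auto simp: less_eq_two_def)
  show "x \<le> y \<or> y \<le> x"
    by (cases x; cases y) (simp_all add: less_eq_two_def)
qed

end

text \<open>The poset \<open>X\<close> is a type of class \<^class>\<open>order\<close>, so total maps on \<open>X\<close> are plain functions.
  Fixed points are only forbidden when \<open>X\<close> has at least two elements; this is written as
  \<open>\<exists>x y. x \<noteq> y\<close> because \<^const>\<open>card\<close> is \<open>0\<close> on infinite sets.\<close>

definition strongly_involution :: "('a::order \<Rightarrow> 'a) \<Rightarrow> bool"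
  where "strongly_involution c \<longleftrightarrow>
    (\<forall>x. c (c x) = x) \<and>
    (\<forall>x y. x \<le> y \<longrightarrow> c y \<le> c x) \<and>
    ((\<exists>x y :: 'a. x \<noteq> y) \<longrightarrow> (\<forall>x. c x \<noteq> x))"

definition up :: "'a::order set \<Rightarrow> 'a set"
  where "up Z = {x. \<exists>z\<in>Z. z \<le> x}"

definition down :: "'a::order set \<Rightarrow> 'a set"
  where "down Z = {x. \<exists>z\<in>Z. x \<le> z}"

definition up_set :: "'a::order set \<Rightarrow> bool"
  where "up_set Z \<longleftrightarrow> (\<forall>z x. z \<in> Z \<longrightarrow> z \<le> x \<longrightarrow> x \<in> Z)"

definition down_set :: "'a::order set \<Rightarrow> bool"
  where "down_set Z \<longleftrightarrow> (\<forall>z x. z \<in> Z \<longrightarrow> x \<le> z \<longrightarrow> x \<in> Z)"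

definition P_part :: "('a \<Rightarrow> two) \<Rightarrow> 'a set \<Rightarrow> 'a set"
  where "P_part A Z = A -` {two_P} \<inter> Z"

definition N_part :: "('a \<Rightarrow> two) \<Rightarrow> 'a set \<Rightarrow> 'a set"
  where "N_part A Z = A -` {two_N} \<inter> Z"

definition W_plus :: "('a::order \<Rightarrow> 'a) \<Rightarrow> ('a \<Rightarrow> two) set"
  where "W_plus c = {A. up_set (A -` {two_P}) \<and> down_set (A -` {two_N}) \<and>
    c ` (A -` {two_N}) \<subseteq> A -` {two_P}}"

definition W_minus :: "('a::order \<Rightarrow> 'a) \<Rightarrow> ('a \<Rightarrow> two) set"
  where "W_minus c = {A. up_set (A -` {two_P}) \<and> down_set (A -` {two_N}) \<and>
    c ` (A -` {two_P}) \<subseteq> A -` {two_N}}"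

definition is_core :: "('a \<Rightarrow> two) set \<Rightarrow> ('a \<Rightarrow> two) \<Rightarrow> 'a set \<Rightarrow> bool"
  where "is_core H A W \<longleftrightarrow> (\<forall>A'\<in>H. (\<forall>w\<in>W. A' w = A w) \<longrightarrow> A' = A)"

definition is_disjoint_union :: "'a set \<Rightarrow> 'a set \<Rightarrow> 'a set \<Rightarrow> bool"
  where "is_disjoint_union X S T \<longleftrightarrow> X = S \<union> T \<and> S \<inter> T = {}"

end

theory Submission imports Defs begin

text \<open>For (i): the map with \<open>N\<close>-set \<open>\<down>W\<^sub>N\<close> lies in \<open>\<W>\<^sub>+\<close> and agrees with \<open>A\<close> on \<open>W\<close>, so
  the core property gives \<open>A\<^sup>-\<^sup>1(N) = \<down>W\<^sub>N\<close>. If some point of \<open>A\<^sup>-\<^sup>1(P)\<close> were not covered by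
  \<open>\<up>W\<^sub>P \<union> \<up>(W\<^sub>N)\<^sup>c\<close>, then switching a minimal such point to \<open>N\<close> would give another member of
  \<open>\<W>\<^sub>+\<close> that agrees with \<open>A\<close> on \<open>W\<close>. Part (ii) is part (i) for the map sending \<open>x\<close> to the
  opposite of \<open>A (x\<^sup>c)\<close>, with core \<open>W\<^sup>c\<close>.\<close>

lemma not_two_N_iff [simp]: "a \<noteq> two_N \<longleftrightarrow> a = two_P"
  by (cases a) auto

text \<open>The two preimages are complementary, so the closure conditions are contrapositives of
  each other.\<close>

lemma up_set_P_iff: "up_set (A -` {two_P}) \<longleftrightarrow> down_set (A -` {two_N})"
  unfolding up_set_def down_set_def vimage_singleton_eq not_two_N_iff[symmetric] by blast

lemma W_plus_iff:
  "A \<in> W_plus c \<longleftrightarrow>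
    (\<forall>x y. x \<le> y \<longrightarrow> A y = two_N \<longrightarrow> A x = two_N) \<and>
    (\<forall>x. A x = two_N \<longrightarrow> A (c x) = two_P)"
  unfolding W_plus_def mem_Collect_eq up_set_P_iff
  by (auto simp: down_set_def image_subset_iff)

lemma W_minus_iff:
  "A \<in> W_minus c \<longleftrightarrow>
    (\<forall>x y. x \<le> y \<longrightarrow> A y = two_N \<longrightarrow> A x = two_N) \<and>
    (\<forall>x. A x = two_P \<longrightarrow> A (c x) = two_N)"
  unfolding W_minus_def mem_Collect_eq up_set_P_iff
  by (auto simp: down_set_def image_subset_iff)

lemma is_coreD:
  assumes "is_core H A W" "B \<in> H" "\<And>w. w \<in> W \<Longrightarrow> B w = A w"
  shows "B = A"
  using assms by (auto simp: is_core_def)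

text \<open>Shrinking the \<open>N\<close>-set of \<open>A\<close> to a smaller down-set only
  weakens the demand that \<open>c\<close> send it into the \<open>P\<close>-set. The least down-set
  containing the \<open>N\<close>-points of \<open>W\<close> is thus the \<open>N\<close>-set of a
  competitor of \<open>A\<close>.\<close>

lemma W_plus_core_N:
  assumes A: "A \<in> W_plus c" and core: "is_core (W_plus c) A W"
  shows "A -` {two_N} = down (N_part A W)"
proof -
  define T where "T = down (N_part A W)"
  define B where "B = (\<lambda>x. if x \<in> T then two_N else two_P)"
  have T_N: "A x = two_N" if "x \<in> T" for x
    using that A by (auto simp: T_def down_def N_part_def W_plus_iff)
  have "B \<in> W_plus c"
    unfolding W_plus_iff
  proof (intro conjI allI impI)
    show "B x = two_N" if "x \<le> y" "B y = two_N" for x y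
      using that by (auto simp: B_def T_def down_def split: if_splits intro: order_trans)
    \<comment> \<open>If \<open>x\<close> and \<open>c x\<close> were both in \<open>T\<close>, then
      \<open>A\<close> would be \<open>N\<close> at both.\<close>
    show "B (c x) = two_P" if "B x = two_N" for x
      using that A T_N[of x] T_N[of "c x"]
      by (auto simp: B_def W_plus_iff split: if_splits)
  qed
  moreover have "B w = A w" if "w \<in> W" for w
  proof (cases "A w")
    case two_N
    then have "w \<in> T"
      using that by (auto simp: T_def down_def N_part_def)
    with two_N show ?thesis by (simp add: B_def)
  next
    case two_P
    with T_N[of w] show ?thesis by (auto simp: B_def)
  qed
  ultimately have "B = A"
    by (rule is_coreD[OF core])
  moreover have "B -` {two_N} = T"
    by (auto simp: B_def split: if_splits)
  ultimately show ?thesis by (simp add: T_def)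
qed

lemma W_plus_core_P:
  fixes c :: "'a::{finite, order} \<Rightarrow> 'a"
  assumes invol: "\<And>x. c (c x) = x" and anti: "\<And>x y. x \<le> y \<Longrightarrow> c y \<le> c x"
    and no_fixpoint: "\<And>x. c x \<noteq> x"
    and A: "A \<in> W_plus c" and core: "is_core (W_plus c) A W"
  shows "A -` {two_P} = up (P_part A W) \<union> up (c ` N_part A W)"
proof -
  define S where "S = up (P_part A W) \<union> up (c ` N_part A W)"
  have mono: "A x = two_N" if "x \<le> y" "A y = two_N" for x y
    using that A by (auto simp: W_plus_iff)
  have c_N: "A (c x) = two_P" if "A x = two_N" for x
    using that A by (auto simp: W_plus_iff)
  have S_up: "y \<in> S" if "x \<in> S" "x \<le> y" for x y
    using that by (auto simp: S_def up_def intro: order_trans)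
  have S_P: "A x = two_P" if "x \<in> S" for x
  proof -
    from that obtain z where "z \<le> x" "A z = two_P"
      by (auto simp: S_def up_def P_part_def N_part_def intro: c_N)
    then show ?thesis using mono[of z x] by (cases "A x") auto
  qed
  have "A -` {two_P} - S = {}"
  proof (rule ccontr)
    assume "A -` {two_P} - S \<noteq> {}"
    then obtain x where x: "A x = two_P" "x \<notin> S"
      and min: "\<And>y. y \<le> x \<Longrightarrow> A y = two_P \<Longrightarrow> y \<notin> S \<Longrightarrow> y = x"
      using finite_has_minimal[of "A -` {two_P} - S"] by auto
    \<comment> \<open>A \<open>P\<close>-point strictly below \<open>x\<close> would lie in
      \<open>S\<close> by minimality, and then so would \<open>x\<close>, since \<open>S\<close> is
      an up-set.\<close>
    have below_x: "A y = two_N" if "y \<le> x" "y \<noteq> x" for y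
      using that x min[of y] S_up[of y x] by (cases "A y") auto
    \<comment> \<open>Otherwise \<open>c x\<close> \<le> \<open>w\<close> for some
      \<open>N\<close>-point \<open>w\<close> of \<open>W\<close>; applying \<open>c\<close> puts
      \<open>x\<close> above \<open>c w\<close>, hence in \<open>S\<close>.\<close>
    have cx: "A (c x) = two_P"
    proof (rule ccontr)
      assume "A (c x) \<noteq> two_P"
      then have "c x \<in> down (N_part A W)"
        using W_plus_core_N[OF A core] by (cases "A (c x)") auto
      then obtain w where "w \<in> N_part A W" "c w \<le> x"
        using anti[of "c x"] by (auto simp: down_def invol)
      with x show False by (auto simp: S_def up_def)
    qed
    define B where "B = A(x := two_N)"
    have "B \<in> W_plus c"
      unfolding W_plus_iff
    proof (intro conjI allI impI)
      show "B y = two_N" if "y \<le> z" "B z = two_N" for y z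
        using that mono[of y z] below_x[of y] by (auto simp: B_def split: if_splits)
      \<comment> \<open>For \<open>y = x\<close>, the value at \<open>c x\<close> is unchanged
        because \<open>c x\<close> differs from \<open>x\<close>. For other \<open>y\<close>,
        \<open>c y = x\<close> is impossible: it would make \<open>y = c x\<close> a
        \<open>P\<close>-point of \<open>A\<close>.\<close>
      show "B (c y) = two_P" if "B y = two_N" for y
        using that cx c_N[of y] no_fixpoint invol[of y]
        by (auto simp: B_def split: if_splits)
    qed
    \<comment> \<open>A \<open>P\<close>-point of \<open>W\<close> lies in
      \<open>up (P_part A W)\<close>, hence in \<open>S\<close>.\<close>
    moreover have "x \<notin> W"
      using x by (auto simp: S_def up_def P_part_def)
    then have "B w = A w" if "w \<in> W" for w
      using that by (auto simp: B_def)
    ultimately have "B = A"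
      by (rule is_coreD[OF core])
    then have "B x = A x" by simp
    with x show False by (simp add: B_def)
  qed
  then show ?thesis using S_P by (auto simp: S_def)
qed

lemma W_plus_core_disjoint_union:
  fixes c :: "'a::{finite, order} \<Rightarrow> 'a"
  assumes "\<And>x. c (c x) = x" "\<And>x y. x \<le> y \<Longrightarrow> c y \<le> c x" "\<And>x. c x \<noteq> x"
    and "A \<in> W_plus c" "is_core (W_plus c) A W"
  shows "is_disjoint_union UNIV
    (up (P_part A W) \<union> up (c ` N_part A W)) (down (N_part A W))"
proof -
  have "is_disjoint_union UNIV (A -` {two_P}) (A -` {two_N})"
    unfolding is_disjoint_union_def using two.exhaust by (auto simp: set_eq_iff)
  then show ?thesis
    using W_plus_core_N[of A c W] W_plus_core_P[of c A W] assms by simp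
qed

text \<open>The order duality of the chain; combined with \<open>c\<close> it exchanges
  \<open>W_plus c\<close> and \<open>W_minus c\<close>.\<close>

definition flip_two :: "two \<Rightarrow> two"
  where "flip_two a = (if a = two_N then two_P else two_N)"

lemma flip_two_simps [simp]:
  "flip_two a = two_N \<longleftrightarrow> a = two_P"
  "flip_two a = two_P \<longleftrightarrow> a = two_N"
  "flip_two (flip_two a) = a"
  by (cases a; simp add: flip_two_def)+

context
  fixes c :: "'a::order \<Rightarrow> 'a"
  assumes invol: "\<And>x. c (c x) = x" and anti: "\<And>x y. x \<le> y \<Longrightarrow> c y \<le> c x"
begin

lemma image_invol_iff: "x \<in> c ` Z \<longleftrightarrow> c x \<in> Z"
  using invol by (metis image_iff)

lemma up_image_invol: "up (c ` Z) = c ` down Z"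
proof (rule set_eqI)
  fix x
  have "c z \<le> x \<longleftrightarrow> c x \<le> z" for z
    using anti[of "c z" x] anti[of "c x" z] by (auto simp: invol)
  then show "x \<in> up (c ` Z) \<longleftrightarrow> x \<in> c ` down Z"
    by (simp add: up_def down_def image_invol_iff)
qed

lemma down_image_invol: "down (c ` Z) = c ` up Z"
proof -
  have "c ` c ` S = S" for S
    by (simp add: image_comp invol)
  then show ?thesis
    \<comment> \<open>This instance reads \<open>up Z = c\<close> down (c \<open>Z)\<close>; taking
      images under \<open>c\<close> gives the claim.\<close>
    using up_image_invol[of "c ` Z"] by simp
qed

lemma is_disjoint_union_image_invol:
  "is_disjoint_union UNIV (c ` S) (c ` T) \<longleftrightarrow> is_disjoint_union UNIV S T"
proof -
  have "bij c"
    using invol by (intro o_bij[of c c]) (auto simp: fun_eq_iff)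
  then have "c ` S \<union> c ` T = UNIV \<longleftrightarrow> S \<union> T = UNIV"
    by (metis bij_def image_Un inj_image_eq_iff)
  moreover have "c ` S \<inter> c ` T = {} \<longleftrightarrow> S \<inter> T = {}"
    using \<open>bij c\<close> by (metis bij_is_inj image_Int image_is_empty)
  ultimately show ?thesis
    by (auto simp: is_disjoint_union_def)
qed

text \<open>The order reversals of \<open>flip_two\<close> and \<open>c\<close> cancel, so
  monotonicity is preserved, while \<open>flip_two\<close> exchanges the two compatibility
  conditions with \<open>c\<close>.\<close>

lemma flip_in_W_plus_iff: "flip_two \<circ> A \<circ> c \<in> W_plus c \<longleftrightarrow> A \<in> W_minus c"
proof -
  have "(\<forall>x y. x \<le> y \<longrightarrow> A (c y) = two_P \<longrightarrow> A (c x) = two_P) \<longleftrightarrow>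
      (\<forall>x y. x \<le> y \<longrightarrow> A y = two_N \<longrightarrow> A x = two_N)" (is "?L \<longleftrightarrow> ?R")
  proof (intro iffI allI impI)
    fix x y assume ?L "x \<le> y" "A y = two_N"
    then show "A x = two_N"
      using anti[of x y] invol[of x] invol[of y] by (cases "A x") force+
  next
    fix x y assume ?R "x \<le> y" "A (c y) = two_P"
    then show "A (c x) = two_P"
      using anti[of x y] by (cases "A (c x)") force+
  qed
  moreover have "(\<forall>x. A (c x) = two_P \<longrightarrow> A x = two_N) \<longleftrightarrow>
      (\<forall>x. A x = two_P \<longrightarrow> A (c x) = two_N)"
    by (metis invol)
  ultimately show ?thesis
    unfolding W_plus_iff W_minus_iff by (simp add: invol)
qed

lemma is_core_flip:
  assumes "is_core (W_minus c) A W"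
  shows "is_core (W_plus c) (flip_two \<circ> A \<circ> c) (c ` W)"
  unfolding is_core_def
proof (intro ballI impI)
  fix B assume B: "B \<in> W_plus c" and eq: "\<forall>w\<in>c ` W. B w = (flip_two \<circ> A \<circ> c) w"
  have flip_flip: "flip_two \<circ> (flip_two \<circ> B \<circ> c) \<circ> c = B"
    by (simp add: fun_eq_iff invol)
  have "flip_two \<circ> B \<circ> c = A"
  proof (rule is_coreD[OF assms])
    show "flip_two \<circ> B \<circ> c \<in> W_minus c"
      using B flip_in_W_plus_iff[of "flip_two \<circ> B \<circ> c"] by (simp only: flip_flip)
  qed (use eq invol in simp)
  then show "B = flip_two \<circ> A \<circ> c"
    using flip_flip by simp
qed

lemma P_part_flip: "P_part (flip_two \<circ> A \<circ> c) (c ` W) = c ` N_part A W"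
  and N_part_flip: "N_part (flip_two \<circ> A \<circ> c) (c ` W) = c ` P_part A W"
  by (simp_all add: P_part_def N_part_def set_eq_iff image_invol_iff)

text \<open>Each set in the first decomposition is the image under the bijection \<open>c\<close> of
  its counterpart in the second.\<close>

lemma disjoint_union_flip_iff:
  "is_disjoint_union UNIV
      (up (P_part (flip_two \<circ> A \<circ> c) (c ` W)) \<union> up (c ` N_part (flip_two \<circ> A \<circ> c) (c ` W)))
      (down (N_part (flip_two \<circ> A \<circ> c) (c ` W))) \<longleftrightarrow>
    is_disjoint_union UNIV
      (down (N_part A W) \<union> down (c ` P_part A W)) (up (P_part A W))"
  unfolding P_part_flip N_part_flip up_image_invol down_image_invol[of "P_part A W"]
    image_Un[symmetric] is_disjoint_union_image_invol ..

end

lemma W_minus_core_disjoint_union: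
  fixes c :: "'a::{finite, order} \<Rightarrow> 'a"
  assumes c: "\<And>x. c (c x) = x" "\<And>x y. x \<le> y \<Longrightarrow> c y \<le> c x" "\<And>x. c x \<noteq> x"
    and A: "A \<in> W_minus c" "is_core (W_minus c) A W"
  shows "is_disjoint_union UNIV
    (down (N_part A W) \<union> down (c ` P_part A W)) (up (P_part A W))"
proof (rule iffD1[OF disjoint_union_flip_iff[of c A W]])
  show "is_disjoint_union UNIV
      (up (P_part (flip_two \<circ> A \<circ> c) (c ` W)) \<union> up (c ` N_part (flip_two \<circ> A \<circ> c) (c ` W)))
      (down (N_part (flip_two \<circ> A \<circ> c) (c ` W)))"
  proof (rule W_plus_core_disjoint_union)
    show "flip_two \<circ> A \<circ> c \<in> W_plus c"
      by (rule iffD2[OF flip_in_W_plus_iff, OF _ _ A(1)]) (fact c)+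
    show "is_core (W_plus c) (flip_two \<circ> A \<circ> c) (c ` W)"
      by (rule is_core_flip[OF _ _ A(2)]) (fact c)+
  qed (fact c)+
qed (fact c)+

theorem theorem3p7:
  fixes c :: "'a::{finite, order} \<Rightarrow> 'a"
  assumes "strongly_involution c"
    and "card (UNIV :: 'a set) \<ge> 2"
  shows "(\<forall>A W. A \<in> W_plus c \<longrightarrow> is_core (W_plus c) A W \<longrightarrow>
            is_disjoint_union UNIV
              (up (P_part A W) \<union> up (c ` N_part A W)) (down (N_part A W))) \<and>
         (\<forall>A W. A \<in> W_minus c \<longrightarrow> is_core (W_minus c) A W \<longrightarrow>
            is_disjoint_union UNIV
              (down (N_part A W) \<union> down (c ` P_part A W)) (up (P_part A W)))"
proof -
  \<comment> \<open>Two points are needed to exclude fixed points of \<open>c\<close>. On a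
    one-point poset the constant \<open>P\<close> map is the only member of \<open>W_plus c\<close>,
    the empty set is a core for it, and the claimed union is empty.\<close>
  have "\<not> card (UNIV :: 'a set) \<le> Suc 0"
    using assms(2) by linarith
  then have "\<exists>x y :: 'a. x \<noteq> y"
    by (simp add: card_le_Suc0_iff_eq)
  with assms(1) have c: "\<forall>x. c (c x) = x" "\<forall>x y. x \<le> y \<longrightarrow> c y \<le> c x" "\<forall>x. c x \<noteq> x"
    unfolding strongly_involution_def by blast+
  show ?thesis
  proof (intro conjI allI impI)
    fix A W
    assume "A \<in> W_plus c" "is_core (W_plus c) A W"
    with c show "is_disjoint_union UNIV
        (up (P_part A W) \<union> up (c ` N_part A W)) (down (N_part A W))"
      by (intro W_plus_core_disjoint_union) blast+
  next
    fix A W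
    assume "A \<in> W_minus c" "is_core (W_minus c) A W"
    with c show "is_disjoint_union UNIV
        (down (N_part A W) \<union> down (c ` P_part A W)) (up (P_part A W))"
      by (intro W_minus_core_disjoint_union) blast+
  qed
qed

end
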